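(* Let $n\ge 1$. For a function $p:S^n\to\mathbb{R}$ consider the following condition. (M) For all $x,y\in S^n$, every integer $k\ge 1$, all $y_1,\dots,y_k\in S^n$ and all real numbers $\alpha_1,\dots,\alpha_k$: if $$x-y=\sum_{i=1}^k\alpha_i(x-y_i),\qquad \alpha_i\ge 0\ (i=1,\dots,k),\qquad \sum_{i=1}^k\alpha_i>0,$$ and the vectors $x-y_1,\dots,x-y_k$ are linearly independent, then $$p(y)\le\sum_{i=1}^k\alpha_i\,p(y_i).$$ Then: (a) If $R\in\mathcal{R}$ is a nondegenerate convex reflector and $p$ is its focal function, then $p$ is a positive bounded function on $S^n$ and $p$ satisfies (M). (b) Conversely, if $p$ is a positive bounded function on $S^n$ satisfying (M), then there exists a unique reflector $R\in\mathcal{R}$ whose focal function is $p$.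
   Context: Fix the origin $\mathcal{O}$ of $\mathbb{R}^{n+1}$, $n\ge 1$; $S^n$ is the unit sphere centered at $\mathcal{O}$. Paraboloids: "paraboloid" always means a paraboloid of revolution with focus $\mathcal{O}$ and axis direction $y\in S^n$ pointing towards its opening. It is denoted $P(y)$; its polar equation is $\rho_y(x)=\tilde p/(1-\langle x,y\rangle)$, $x\in S^n\setminus\{y\}$, where $\tilde p\ge 0$ is its focal parameter. Equivalently, $P(y)=\{X\in\mathbb{R}^{n+1}: |X|-\langle X,y\rangle=\tilde p\}$. $B(y)=\{X: |X|-\langle X,y\rangle\le\tilde p\}$ is the closed convex set bounded by $P(y)$ and containing its axis. If $\tilde p=0$ the paraboloid is degenerate (the ray from $\mathcal{O}$ in direction $y$); if $\tilde p=\infty$ it is improper and $B(y)=\mathbb{R}^{n+1}$. Reflectors: given a family $\{P(y): y\in S^n\}$ (one paraboloid for each $y$, with focal parameters $\tilde p(y)\in[0,\infty]$), put $B=\bigcap_{y\in S^n}B(y)$ and $R=\partial B$. If $B$ is compact with nonempty interior in $\mathbb{R}^{n+1}$, then $R$ is called a (nondegenerate) convex reflector with light source $\mathcal{O}$. The set of all nondegenerate convex reflectors with light source $\mathcal{O}$ is denoted $\mathcal{R}$. A paraboloid $P(y)$ is supporting to a set $A\subset\mathbb{R}^{n+1}$ if $A\subset B(y)$ and $P(y)\cap A\ne\emptyset$. It is known that for each $R\in\mathcal{R}$ and each $y\in S^n$ there is a unique paraboloid $P(y)$ supporting to $R$ (not necessarily from the family defining $R$). The focal function of $R\in\mathcal{R}$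 is the function $p:S^n\to\mathbb{R}$ assigning to $y$ the focal parameter of the paraboloid $P(y)$ supporting to $R$. *)

theory Defs
  imports "HOL-Analysis.Analysis"
begin

text \<open>
  All paraboloids are paraboloids of revolution with focus \<open>0\<close>, given by an axis
  direction \<open>y\<close> (a unit vector) and a focal parameter \<open>t\<close> in \<open>[0, \<infinity>]\<close>. Since
  \<open>norm X - X \<bullet> y \<ge> 0\<close> for unit \<open>y\<close>, the coercion \<open>ennreal\<close> loses nothing here.
  For \<open>t = 0\<close> both sets below are the ray from \<open>0\<close> in direction \<open>y\<close>; for \<open>t = \<infinity>\<close>
  (improper paraboloid) the surface is empty and the body is the whole space.
\<close>

definition paraboloid :: "'a::euclidean_space \<Rightarrow> ennreal \<Rightarrow> 'a set" where
  "paraboloid y t = {X. ennreal (norm X - X \<bullet> y) = t}"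

definition paraboloid_body :: "'a::euclidean_space \<Rightarrow> ennreal \<Rightarrow> 'a set" where
  "paraboloid_body y t = {X. ennreal (norm X - X \<bullet> y) \<le> t}"

definition reflector_body :: "('a::euclidean_space \<Rightarrow> ennreal) \<Rightarrow> 'a set" where
  "reflector_body q = (\<Inter>y\<in>sphere 0 1. paraboloid_body y (q y))"

definition reflectors :: "'a::euclidean_space set set" where
  "reflectors = {frontier (reflector_body q) | q.
     compact (reflector_body q) \<and> interior (reflector_body q) \<noteq> {}}"

definition supporting :: "'a::euclidean_space \<Rightarrow> ennreal \<Rightarrow> 'a set \<Rightarrow> bool" where
  "supporting y t A \<longleftrightarrow> A \<subseteq> paraboloid_body y t \<and> paraboloid y t \<inter> A \<noteq> {}"

text \<open>Only the values at unit vectors are meaningful; there the description is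
  proper and finite for every reflector, see \<open>focal_function_supporting\<close>.\<close>

definition focal_function :: "'a::euclidean_space set \<Rightarrow> 'a \<Rightarrow> real" where
  "focal_function R y = enn2real (THE t. supporting y t R)"

text \<open>Linear independence is that of the indexed family \<open>(x - y\<^sub>i)\<close>, so repetitions
  are excluded by injectivity.\<close>

definition condition_M :: "('a::euclidean_space \<Rightarrow> real) \<Rightarrow> bool" where
  "condition_M p \<longleftrightarrow>
    (\<forall>x\<in>sphere 0 1. \<forall>y\<in>sphere 0 1. \<forall>k\<ge>1::nat. \<forall>(ys :: nat \<Rightarrow> 'a) (\<alpha> :: nat \<Rightarrow> real).
      (\<forall>i\<in>{1..k}. ys i \<in> sphere 0 1) \<longrightarrow>
      x - y = (\<Sum>i=1..k. \<alpha> i *\<^sub>R (x - ys i)) \<longrightarrow>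
      (\<forall>i\<in>{1..k}. \<alpha> i \<ge> 0) \<longrightarrow>
      (\<Sum>i=1..k. \<alpha> i) > 0 \<longrightarrow>
      inj_on (\<lambda>i. x - ys i) {1..k} \<longrightarrow>
      independent ((\<lambda>i. x - ys i) ` {1..k}) \<longrightarrow>
      p y \<le> (\<Sum>i=1..k. \<alpha> i * p (ys i)))"

lemma supporting_unique:
  assumes "supporting y s A" and "supporting y t A"
  shows "s = t"
  using assms unfolding supporting_def paraboloid_def paraboloid_body_def
  by (auto intro!: antisym)

lemma supporting_ex1:
  fixes R :: "'a::euclidean_space set"
  assumes "R \<in> reflectors"
  shows "\<exists>!t. supporting y t R"
proof -
  obtain B :: "'a set" where B: "compact B" "interior B \<noteq> {}" "R = frontier B"
    using assms unfolding reflectors_def by auto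
  have "compact R"
    using B by (simp add: compact_frontier)
  moreover have "R \<noteq> {}"
    using B by (auto simp: frontier_eq_empty)
  moreover have "continuous_on R (\<lambda>X. norm X - X \<bullet> y)"
    by (intro continuous_intros)
  ultimately obtain Z where "Z \<in> R" "\<forall>X\<in>R. norm X - X \<bullet> y \<le> norm Z - Z \<bullet> y"
    using continuous_attains_sup by blast
  then have "supporting y (ennreal (norm Z - Z \<bullet> y)) R"
    unfolding supporting_def paraboloid_def paraboloid_body_def
    by (auto intro: ennreal_leI)
  then show ?thesis
    using supporting_unique by blast
qed

lemma focal_function_supporting:
  fixes R :: "'a::euclidean_space set"
  assumes "R \<in> reflectors"
  shows "supporting y (ennreal (focal_function R y)) R"
proof -
  obtain t where t: "supporting y t R"
    using supporting_ex1[OF assms] by blast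
  then have "(THE t. supporting y t R) = t"
    using supporting_unique by blast
  moreover have "t < top"
    using t unfolding supporting_def paraboloid_def by (auto simp: less_top)
  ultimately show ?thesis
    using t by (simp add: focal_function_def)
qed

end

theory Submission
  imports Defs
begin

text \<open>
  For a reflector with focal function \<open>p\<close>, \<open>p y\<close> is the maximum of \<open>norm X - X \<bullet> y\<close> over the reflector. If
  \<open>x - y = (\<Sum>i. \<alpha> i (x - y i))\<close> with \<open>s = (\<Sum>i. \<alpha> i)\<close>, then
  \<open>norm X - X \<bullet> y = (\<Sum>i. \<alpha> i (norm X - X \<bullet> y i)) - (s - 1) (norm X - X \<bullet> x)\<close>, and \<open>s \<ge> 1\<close> because
  otherwise the unit vector \<open>y\<close> would be a proper convex combination of unit vectors; this gives (M).

  Conversely, for fixed \<open>x\<close> the case \<open>k = 2\<close> of (M) already says that the homogeneous extension of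
  \<open>x - z \<mapsto> p z\<close> to the half-space \<open>v \<bullet> x > 0\<close> is sublinear. Its subgradient at \<open>x - y\<close> is an affine
  minorant of \<open>p\<close> on the sphere that touches \<open>p\<close> at \<open>y\<close> and vanishes at \<open>x\<close>. A point of the body
  supporting at \<open>y\<close> is such a minorant whose minimum over the sphere is \<open>0\<close>; it is found by maximising
  this minimum over all minorants touching at \<open>y\<close>, followed by the intermediate value theorem.
  The body has interior points since the maximum \<open>p\<close> is Lipschitz and so bounded away from \<open>0\<close>.
\<close>

section \<open>The focal function as a maximum over the reflector body\<close>

lemma norm_minus_inner_nonneg:
  fixes y :: "'a::real_inner"
  assumes "norm y = 1"
  shows "0 \<le> norm X - X \<bullet> y"
  using norm_cauchy_schwarz[of X y] assms by simp

lemma unit_inner_less_1: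
  fixes x y :: "'a::real_inner"
  assumes "norm x = 1" "norm y = 1" "x \<noteq> y"
  shows "x \<bullet> y < 1"
proof -
  have "0 < (x - y) \<bullet> (x - y)"
    using assms by simp
  moreover have "x \<bullet> x = 1" "y \<bullet> y = 1"
    using assms by (simp_all add: dot_square_norm)
  ultimately show ?thesis
    by (simp add: inner_diff_left inner_diff_right inner_commute)
qed

lemma reflector_body_ennreal:
  fixes p :: "'a::euclidean_space \<Rightarrow> real"
  assumes "\<And>y. norm y = 1 \<Longrightarrow> 0 \<le> p y"
  shows "reflector_body (\<lambda>y. ennreal (p y)) = {X. \<forall>y. norm y = 1 \<longrightarrow> norm X - X \<bullet> y \<le> p y}"
  using assms by (auto simp: reflector_body_def paraboloid_body_def ennreal_le_iff)

text \<open>The function is positively homogeneous of degree one, so a positive maximum cannot sit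
  at an interior point \<open>M\<close>: moving outward along \<open>M\<close> would increase
  it.\<close>

lemma frontier_dominates:
  fixes B :: "'a::euclidean_space set"
  assumes B: "compact B" and Z: "Z \<in> B" and y: "norm y = 1"
  shows "\<exists>X\<in>frontier B. norm Z - Z \<bullet> y \<le> norm X - X \<bullet> y"
proof -
  have "continuous_on B (\<lambda>X. norm X - X \<bullet> y)"
    by (intro continuous_intros)
  then obtain M where M: "M \<in> B" "\<And>X. X \<in> B \<Longrightarrow> norm X - X \<bullet> y \<le> norm M - M \<bullet> y"
    using continuous_attains_sup[of B "\<lambda>X. norm X - X \<bullet> y"] B Z by blast
  show ?thesis
  proof (cases "norm M - M \<bullet> y = 0")
    case True
    \<comment> \<open>The function is nonnegative and its maximum is 0, so any frontier point will
      do.\<close>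
    have "B \<noteq> UNIV"
      using B not_compact_UNIV by blast
    then obtain X where "X \<in> frontier B"
      using Z frontier_eq_empty[of B] by blast
    moreover have "norm Z - Z \<bullet> y \<le> norm X - X \<bullet> y"
      using M(2)[OF Z] True norm_minus_inner_nonneg[OF y, of X] by linarith
    ultimately show ?thesis by blast
  next
    case False
    then have pos: "0 < norm M - M \<bullet> y"
      using norm_minus_inner_nonneg[OF y, of M] by linarith
    then have "M \<noteq> 0" by auto
    have "M \<notin> interior B"
    proof
      assume "M \<in> interior B"
      then obtain e where e: "0 < e" "cball M e \<subseteq> B"
        by (auto simp: mem_interior_cball)
      define s where "s = e / norm M"
      have "s > 0" using e \<open>M \<noteq> 0\<close> by (simp add: s_def)
      have "(1 + s) *\<^sub>R M \<in> cball M e"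
        using e \<open>M \<noteq> 0\<close> by (simp add: dist_norm algebra_simps s_def)
      then have "norm ((1 + s) *\<^sub>R M) - (1 + s) *\<^sub>R M \<bullet> y \<le> norm M - M \<bullet> y"
        using M(2) e by blast
      then have "(1 + s) * (norm M - M \<bullet> y) \<le> norm M - M \<bullet> y"
        using \<open>s > 0\<close> unfolding norm_scaleR inner_scaleR_left right_diff_distrib by simp
      then have "s * (norm M - M \<bullet> y) \<le> 0"
        by (simp add: algebra_simps)
      then show False
        using pos \<open>s > 0\<close> by (simp add: mult_le_0_iff)
    qed
    then have "M \<in> frontier B"
      using M(1) B by (simp add: frontier_def compact_imp_closed)
    then show ?thesis using M(2)[OF Z] by blast
  qed
qed

text \<open>Passes from the frontier to the body: closedness puts the contact point in the body, and
  \<open>frontier_dominates\<close> extends the bound to all of it.\<close>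

lemma focal_function_properties:
  fixes q :: "'a::euclidean_space \<Rightarrow> ennreal"
  assumes comp: "compact (reflector_body q)" and int: "interior (reflector_body q) \<noteq> {}"
    and y: "norm y = 1"
  defines "R \<equiv> frontier (reflector_body q)"
  shows "\<exists>X\<in>reflector_body q. norm X - X \<bullet> y = focal_function R y"
    and "X \<in> reflector_body q \<Longrightarrow> norm X - X \<bullet> y \<le> focal_function R y"
proof -
  have "R \<in> reflectors"
    using comp int by (auto simp: reflectors_def R_def)
  then have supp: "supporting y (ennreal (focal_function R y)) R"
    by (rule focal_function_supporting)
  have nonneg: "0 \<le> focal_function R y"
    by (simp add: focal_function_def)
  have le: "norm X - X \<bullet> y \<le> focal_function R y" if "X \<in> R" for X
    using that supp nonneg by (auto simp: supporting_def paraboloid_body_def ennreal_le_iff)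
  obtain Z where "Z \<in> R" "ennreal (norm Z - Z \<bullet> y) = ennreal (focal_function R y)"
    using supp by (auto simp: supporting_def paraboloid_def)
  then have Z: "Z \<in> R" "norm Z - Z \<bullet> y = focal_function R y"
    using nonneg norm_minus_inner_nonneg[OF y, of Z] by simp_all
  have "R \<subseteq> reflector_body q"
    using comp by (simp add: R_def compact_imp_closed frontier_subset_closed)
  then show "\<exists>X\<in>reflector_body q. norm X - X \<bullet> y = focal_function R y"
    using Z by blast
  show "norm X - X \<bullet> y \<le> focal_function R y" if "X \<in> reflector_body q"
    using frontier_dominates[OF comp that y] le unfolding R_def by force
qed

text \<open>Otherwise equality holds in the Cauchy-Schwarz inequality on all of \<open>B\<close>,
  which confines \<open>B\<close> to a line.\<close>

lemma interior_imp_focal_positive: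
  fixes B :: "'a::euclidean_space set"
  assumes "2 \<le> DIM('a)" "interior B \<noteq> {}" and y: "norm y = 1"
  shows "\<exists>X\<in>B. 0 < norm X - X \<bullet> y"
proof (rule ccontr)
  assume "\<not> ?thesis"
  then have eq: "norm X = X \<bullet> y" if "X \<in> B" for X
    using that norm_minus_inner_nonneg[OF y, of X] by force
  have "B \<subseteq> span {y}"
  proof
    fix X assume "X \<in> B"
    then have "norm X *\<^sub>R y = norm y *\<^sub>R X"
      using eq y norm_cauchy_schwarz_eq[of X y] by simp
    then have "X = norm X *\<^sub>R y" using y by simp
    then show "X \<in> span {y}"
      by (metis span_base span_mul insertI1)
  qed
  moreover have "dim {y} \<le> 1"
    using dim_le_card'[of "{y}"] by simp
  then have "interior (span {y}) = {}"
    using assms(1) by (intro empty_interior_lowdim) simp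
  ultimately show False
    using assms(2) interior_mono by blast
qed

section \<open>Necessity of (M)\<close>

text \<open>Pairing the relation with \<open>y\<close> and bounding each
  \<open>ys i \<bullet> y\<close> by 1 leaves \<open>(1 - s) * (1 - x \<bullet> y) \<le> 0\<close>
  for the coefficient sum \<open>s\<close>.\<close>

lemma coefficient_sum_ge_1:
  fixes x y :: "'a::real_inner"
  assumes "norm x = 1" "norm y = 1" "x \<noteq> y"
    and ys: "\<And>i. i \<in> I \<Longrightarrow> norm (ys i) = 1"
    and "\<And>i. i \<in> I \<Longrightarrow> 0 \<le> \<alpha> i"
    and eq: "x - y = (\<Sum>i\<in>I. \<alpha> i *\<^sub>R (x - ys i))"
  shows "1 \<le> sum \<alpha> I"
proof -
  have "(x - y) \<bullet> y = (\<Sum>i\<in>I. \<alpha> i * ((x - ys i) \<bullet> y))"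
    by (simp add: eq inner_sum_left)
  also have "\<dots> = sum \<alpha> I * (x \<bullet> y) - (\<Sum>i\<in>I. \<alpha> i * (ys i \<bullet> y))"
    by (simp add: inner_diff_left right_diff_distrib sum_subtractf sum_distrib_right)
  also have "\<dots> \<ge> sum \<alpha> I * (x \<bullet> y) - sum \<alpha> I"
  proof -
    have "(\<Sum>i\<in>I. \<alpha> i * (ys i \<bullet> y)) \<le> (\<Sum>i\<in>I. \<alpha> i * 1)"
    proof (intro sum_mono mult_left_mono)
      show "ys i \<bullet> y \<le> 1" if "i \<in> I" for i
        using norm_cauchy_schwarz[of "ys i" y] ys[OF that] \<open>norm y = 1\<close> by simp
    qed (use assms in auto)
    then show ?thesis by simp
  qed
  finally have "(1 - sum \<alpha> I) * (1 - x \<bullet> y) \<le> 0"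
    using \<open>norm y = 1\<close> by (simp add: inner_diff_left dot_square_norm algebra_simps)
  then show ?thesis
    using unit_inner_less_1[OF assms(1-3)] by (simp add: mult_le_0_iff)
qed

lemma condition_M_max:
  fixes p :: "'a::euclidean_space \<Rightarrow> real"
  assumes att: "\<And>y. norm y = 1 \<Longrightarrow> \<exists>X\<in>B. norm X - X \<bullet> y = p y"
    and le: "\<And>y X. norm y = 1 \<Longrightarrow> X \<in> B \<Longrightarrow> norm X - X \<bullet> y \<le> p y"
  shows "condition_M p"
  unfolding condition_M_def
proof (intro ballI allI impI)
  fix x y :: 'a and k :: nat and ys :: "nat \<Rightarrow> 'a" and \<alpha> :: "nat \<Rightarrow> real"
  assume xy: "x \<in> sphere 0 1" "y \<in> sphere 0 1" and ys: "\<forall>i\<in>{1..k}. ys i \<in> sphere 0 1"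
    and eq: "x - y = (\<Sum>i = 1..k. \<alpha> i *\<^sub>R (x - ys i))"
    and nn: "\<forall>i\<in>{1..k}. 0 \<le> \<alpha> i" and pos: "0 < (\<Sum>i = 1..k. \<alpha> i)"
    and inj: "inj_on (\<lambda>i. x - ys i) {1..k}"
    and ind: "independent ((\<lambda>i. x - ys i) ` {1..k})"
  let ?s = "\<Sum>i = 1..k. \<alpha> i"
  \<comment> \<open>For \<open>x = y\<close>, linear independence would force all
    \<open>\<alpha> i\<close> to vanish, against \<open>pos\<close>.\<close>
  have "x \<noteq> y"
  proof
    assume "x = y"
    then have "(\<Sum>i = 1..k. \<alpha> i *\<^sub>R (x - ys i)) = 0" using eq by simp
    then have "(\<Sum>v\<in>(\<lambda>i. x - ys i) ` {1..k}.
        \<alpha> (the_inv_into {1..k} (\<lambda>i. x - ys i) v) *\<^sub>R v) = 0"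
      unfolding sum.reindex[OF inj] by (simp add: the_inv_into_f_f[OF inj, simplified])
    then have "\<alpha> i = 0" if "i \<in> {1..k}" for i
      using independentD[OF ind _ subset_refl,
          of "\<lambda>v. \<alpha> (the_inv_into {1..k} (\<lambda>i. x - ys i) v)" "x - ys i"] that
        the_inv_into_f_f[OF inj that] by simp
    then show False using pos by simp
  qed
  then have s: "1 \<le> ?s"
    using xy ys nn eq by (intro coefficient_sum_ge_1[of x y]) auto
  obtain X where X: "X \<in> B" "norm X - X \<bullet> y = p y"
    using att[of y] xy by auto
  have "p y = norm X - X \<bullet> x + X \<bullet> (x - y)"
    using X by (simp add: inner_diff_right)
  also have "X \<bullet> (x - y) = (\<Sum>i = 1..k. \<alpha> i * (X \<bullet> (x - ys i)))"
    by (simp add: eq inner_sum_right)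
  also have "\<dots> = (\<Sum>i = 1..k. \<alpha> i * (norm X - X \<bullet> ys i) - \<alpha> i * (norm X - X \<bullet> x))"
    by (intro sum.cong) (simp_all add: inner_diff_right algebra_simps)
  also have "\<dots> = (\<Sum>i = 1..k. \<alpha> i * (norm X - X \<bullet> ys i)) - ?s * (norm X - X \<bullet> x)"
    by (simp add: sum_subtractf sum_distrib_right)
  finally have "p y = (\<Sum>i = 1..k. \<alpha> i * (norm X - X \<bullet> ys i)) - (?s - 1) * (norm X - X \<bullet> x)"
    by (simp add: algebra_simps)
  also have "\<dots> \<le> (\<Sum>i = 1..k. \<alpha> i * (norm X - X \<bullet> ys i))"
    using s norm_minus_inner_nonneg[of x X] xy by (simp add: mult_nonneg_nonneg)
  also have "\<dots> \<le> (\<Sum>i = 1..k. \<alpha> i * p (ys i))"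
    using nn ys X le by (intro sum_mono mult_left_mono) auto
  finally show "p y \<le> (\<Sum>i = 1..k. \<alpha> i * p (ys i))" .
qed

section \<open>Sublinearity of the homogeneous extension and its subgradients\<close>

text \<open>Every \<open>v\<close> with \<open>v \<bullet> x > 0\<close> is a positive multiple of \<open>x - z\<close> for exactly one
  unit vector \<open>z\<close>; this is the positively homogeneous function with value \<open>p z\<close> at \<open>x - z\<close>.\<close>

definition hom_ext :: "('a::real_inner \<Rightarrow> real) \<Rightarrow> 'a \<Rightarrow> 'a \<Rightarrow> real" where
  "hom_ext p x v = (v \<bullet> v) / (2 * (v \<bullet> x)) * p (x - (2 * (v \<bullet> x) / (v \<bullet> v)) *\<^sub>R v)"

lemma hom_ext_scale:
  assumes "0 < s" "0 < v \<bullet> x"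
  shows "hom_ext p x (s *\<^sub>R v) = s * hom_ext p x v"
  using assms by (auto simp: hom_ext_def field_simps)

lemma hom_ext_diff:
  assumes "norm x = 1" "norm z = 1" "x \<noteq> z"
  shows "0 < (x - z) \<bullet> x" "hom_ext p x (x - z) = p z"
proof -
  have "x \<bullet> x = 1" "z \<bullet> z = 1"
    using assms by (simp_all add: dot_square_norm)
  then have eq: "(x - z) \<bullet> (x - z) = 2 * ((x - z) \<bullet> x)" and "(x - z) \<bullet> x = 1 - x \<bullet> z"
    by (simp_all add: inner_diff_left inner_diff_right inner_commute)
  then show pos: "0 < (x - z) \<bullet> x"
    using unit_inner_less_1[OF assms] by simp
  show "hom_ext p x (x - z) = p z"
    unfolding hom_ext_def eq using pos by simp
qed

lemma hom_ext_decompose: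
  assumes "norm x = 1" "0 < v \<bullet> x"
  obtains a z where "0 < a" "norm z = 1" "v = a *\<^sub>R (x - z)" "hom_ext p x v = a * p z"
proof
  \<comment> \<open>The value of \<open>a\<close> is forced by
    \<open>v = a *\<^sub>R (x - z)\<close> with unit \<open>x\<close> and \<open>z\<close>;
    \<open>z\<close> is the mirror image of \<open>x\<close> in the hyperplane orthogonal to
    \<open>v\<close>.\<close>
  define a where "a = (v \<bullet> v) / (2 * (v \<bullet> x))"
  define z where "z = x - (2 * (v \<bullet> x) / (v \<bullet> v)) *\<^sub>R v"
  have "0 < v \<bullet> v" using assms by auto
  then show "0 < a" using assms by (simp add: a_def)
  show "v = a *\<^sub>R (x - z)"
    using \<open>0 < v \<bullet> v\<close> assms by (simp add: a_def z_def)
  have "z \<bullet> z = 1"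
    using \<open>0 < v \<bullet> v\<close> assms
    by (simp add: z_def inner_diff_left inner_diff_right inner_commute dot_square_norm[of x] field_simps)
  then show "norm z = 1" by (simp add: norm_eq_1)
  show "hom_ext p x v = a * p z"
    by (simp add: hom_ext_def a_def z_def)
qed

lemma condition_M_two:
  fixes p :: "'a::euclidean_space \<Rightarrow> real"
  assumes M: "condition_M p" and unit: "norm x = 1" "norm y = 1" "norm u = 1" "norm w = 1"
    and eq: "x - y = a *\<^sub>R (x - u) + b *\<^sub>R (x - w)" and ab: "0 < a" "0 < b"
    and ind: "independent {x - u, x - w}" "u \<noteq> w"
  shows "p y \<le> a * p u + b * p w"
proof -
  have I: "{1..2} = {1, 2::nat}" by auto
  have "x \<in> sphere 0 1" "y \<in> sphere 0 1" using unit by auto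
  with M have "\<forall>k\<ge>1. \<forall>(ys :: nat \<Rightarrow> 'a) (\<alpha> :: nat \<Rightarrow> real).
      (\<forall>i\<in>{1..k}. ys i \<in> sphere 0 1) \<longrightarrow>
      x - y = (\<Sum>i=1..k. \<alpha> i *\<^sub>R (x - ys i)) \<longrightarrow>
      (\<forall>i\<in>{1..k}. \<alpha> i \<ge> 0) \<longrightarrow>
      (\<Sum>i=1..k. \<alpha> i) > 0 \<longrightarrow>
      inj_on (\<lambda>i. x - ys i) {1..k} \<longrightarrow>
      independent ((\<lambda>i. x - ys i) ` {1..k}) \<longrightarrow>
      p y \<le> (\<Sum>i=1..k. \<alpha> i * p (ys i))"
    unfolding condition_M_def by blast
  note this[THEN spec[of _ 2], THEN mp, THEN spec[of _ "\<lambda>i. if i = 1 then u else w"],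
      THEN spec[of _ "\<lambda>i. if i = 1 then a else b"], THEN mp, THEN mp, THEN mp, THEN mp,
      THEN mp, THEN mp]
  then have "p y \<le> (\<Sum>i=1..2. (if i = (1::nat) then a else b) * p (if i = 1 then u else w))"
    by this (use unit eq ab ind in \<open>auto simp: I[simplified] inj_on_def\<close>)
  then show ?thesis unfolding I by simp
qed

text \<open>Parallel vectors are settled by homogeneity. Otherwise dividing
  \<open>v + w = c *\<^sub>R (x - y)\<close> by \<open>c\<close> writes \<open>x - y\<close> as a
  positive combination of two independent vectors, and (M) applies.\<close>

lemma hom_ext_subadditive:
  fixes p :: "'a::euclidean_space \<Rightarrow> real"
  assumes M: "condition_M p" and x: "norm x = 1" and v: "0 < v \<bullet> x" and w: "0 < w \<bullet> x"
  shows "hom_ext p x (v + w) \<le> hom_ext p x v + hom_ext p x w"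
proof (cases "\<exists>s. w = s *\<^sub>R v")
  case True
  then obtain s where s: "w = s *\<^sub>R v" by blast
  then have "0 < s" using v w by (simp add: zero_less_mult_iff)
  have "v + w = (1 + s) *\<^sub>R v" by (simp add: s algebra_simps)
  then show ?thesis
    using hom_ext_scale[of "1 + s" v x p] hom_ext_scale[of s v x p] \<open>0 < s\<close> v s
    by (simp add: algebra_simps)
next
  case False
  obtain a y1 where 1: "0 < a" "norm y1 = 1" "v = a *\<^sub>R (x - y1)" "hom_ext p x v = a * p y1"
    using hom_ext_decompose[OF x v] by blast
  obtain b y2 where 2: "0 < b" "norm y2 = 1" "w = b *\<^sub>R (x - y2)" "hom_ext p x w = b * p y2"
    using hom_ext_decompose[OF x w] by blast
  have "0 < (v + w) \<bullet> x" using v w by (simp add: inner_add_left)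
  then obtain c y where 3: "0 < c" "norm y = 1" "v + w = c *\<^sub>R (x - y)"
      "hom_ext p x (v + w) = c * p y"
    using hom_ext_decompose[OF x] by blast
  have nspan: "x - y2 \<notin> span {x - y1}"
  proof
    assume "x - y2 \<in> span {x - y1}"
    then obtain k where k: "x - y2 = k *\<^sub>R (x - y1)"
      by (auto simp: span_singleton)
    have "w = (b * k / a) *\<^sub>R v"
      using 1 2(3) k by simp
    then show False using False by blast
  qed
  moreover have "x - y1 \<noteq> 0" using v 1 by auto
  ultimately have ind: "independent {x - y1, x - y2}"
    by (subst insert_commute) (simp add: independent_insert)
  have "y1 \<noteq> y2"
    using nspan span_base[of "x - y1" "{x - y1}"] by auto
  have "x - y = (1 / c) *\<^sub>R (v + w)"
    using 3 by simp
  also have "\<dots> = (a / c) *\<^sub>R (x - y1) + (b / c) *\<^sub>R (x - y2)"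
    by (simp add: 1(3) 2(3) scaleR_add_right)
  finally have "p y \<le> a / c * p y1 + b / c * p y2"
    using condition_M_two[OF M x 3(2) 1(2) 2(2), of "a / c" "b / c"] 1 2 3 ind \<open>y1 \<noteq> y2\<close> by simp
  then have "c * p y \<le> c * (a / c * p y1 + b / c * p y2)"
    using 3 by (intro mult_left_mono) auto
  also have "\<dots> = a * p y1 + b * p y2"
    using 3 by (simp add: field_simps)
  finally show ?thesis using 1 2 3 by simp
qed

text \<open>A subgradient of the sublinear function \<open>hom_ext p x\<close> at \<open>x - y\<close>.\<close>

lemma condition_M_subgradient:
  fixes p :: "'a::euclidean_space \<Rightarrow> real"
  assumes M: "condition_M p" and x: "norm x = 1" and y: "norm y = 1" and "x \<noteq> y"
  obtains W where "W \<bullet> (x - y) = p y" "\<And>z. norm z = 1 \<Longrightarrow> z \<noteq> x \<Longrightarrow> W \<bullet> (x - z) \<le> p z"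
proof -
  \<comment> \<open>\<open>A\<close> is the epigraph of \<open>hom_ext p x\<close>, a convex cone;
    \<open>T\<close> is the open vertical ray below its point over \<open>x - y\<close>. A
    separating hyperplane carries the subgradient.\<close>
  define A where "A = {(v, t). 0 < v \<bullet> x \<and> hom_ext p x v \<le> t}"
  define T where "T = {x - y} \<times> {..< p y}"
  note u = hom_ext_diff(1)[OF x y \<open>x \<noteq> y\<close>] hom_ext_diff(2)[OF x y \<open>x \<noteq> y\<close>, of p]
  have scaleA: "s *\<^sub>R q \<in> A" if "q \<in> A" "0 < s" for s q
    using that by (auto simp: A_def hom_ext_scale)
  have addA: "q + r \<in> A" if "q \<in> A" "r \<in> A" for q r
    using that by (auto simp: A_def inner_add_left intro!: order_trans[OF hom_ext_subadditive[OF M x]])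
  have "convex A"
    unfolding convex_alt
  proof (intro ballI allI impI)
    fix q r and s :: real
    assume "q \<in> A" "r \<in> A" "0 \<le> s \<and> s \<le> 1"
    then show "(1 - s) *\<^sub>R q + s *\<^sub>R r \<in> A"
      by (cases "s = 0"; cases "s = 1") (auto intro!: addA scaleA)
  qed
  moreover have "convex T"
    by (simp add: T_def convex_Times)
  moreover have "(x - y, p y) \<in> A"
    using u by (simp add: A_def)
  moreover have "(x - y, p y - 1) \<in> T"
    by (simp add: T_def)
  moreover have "T \<inter> A = {}"
    using u by (auto simp: A_def T_def)
  ultimately obtain n c where n: "n \<noteq> 0"
      and nT: "\<And>q. q \<in> T \<Longrightarrow> n \<bullet> q \<le> c" and nA: "\<And>q. q \<in> A \<Longrightarrow> c \<le> n \<bullet> q"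
    using separating_hyperplane_sets[of T A] by blast
  obtain a b where ab: "n = (a, b)" by (cases n)
  let ?e = "a \<bullet> (x - y) + b * p y"
  \<comment> \<open>Taking \<open>s = 1/2\<close> and \<open>s = 2\<close>, together with the limit
    of \<open>down\<close>, forces \<open>?e = 0\<close> and then \<open>c = 0\<close>.\<close>
  have ray: "c \<le> s * ?e" if "0 < s" for s
    using nA[OF scaleA[OF \<open>(x - y, p y) \<in> A\<close> that]] by (simp add: ab algebra_simps)
  have up: "c \<le> ?e + b"
    using nA[of "(x - y, p y + 1)"] u by (simp add: A_def ab algebra_simps)
  have down: "?e - b * e \<le> c" if "0 < e" for e
    using nT[of "(x - y, p y - e)"] that by (simp add: T_def ab algebra_simps)
  have "?e \<le> c"
  proof (rule field_le_epsilon)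
    fix e :: real assume "0 < e"
    then have "?e - b * (e / (\<bar>b\<bar> + 1)) \<le> c" by (intro down) simp
    moreover have "b * (e / (\<bar>b\<bar> + 1)) \<le> (\<bar>b\<bar> + 1) * (e / (\<bar>b\<bar> + 1))"
      using \<open>0 < e\<close> by (intro mult_right_mono) auto
    moreover have "(\<bar>b\<bar> + 1) * (e / (\<bar>b\<bar> + 1)) = e"
      by simp
    ultimately show "?e \<le> c + e" by linarith
  qed
  then have e0: "?e = 0" and "0 \<ge> c" "c \<ge> 0"
    using ray[of "1/2"] ray[of 1] ray[of 2] by auto
  then have "0 \<le> b" using up by simp
  \<comment> \<open>A vertical hyperplane is impossible because \<open>x - y\<close> lies in the
    open half-space: a step along \<open>- a\<close>, short enough to stay there, makes the
    functional negative.\<close>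
  have "b \<noteq> 0"
  proof
    assume "b = 0"
    then have "a \<noteq> 0" "a \<bullet> (x - y) = 0" using n ab e0 by (auto simp: zero_prod_def)
    define d where "d = (x - y) \<bullet> x / (2 * (\<bar>a \<bullet> x\<bar> + 1))"
    have "0 < d" using u by (simp add: d_def)
    have "d * (a \<bullet> x) \<le> d * (\<bar>a \<bullet> x\<bar> + 1)"
      using \<open>0 < d\<close> by (intro mult_left_mono) auto
    also have "\<dots> = (x - y) \<bullet> x / 2"
      by (simp add: d_def field_simps)
    finally have "0 < (x - y - d *\<^sub>R a) \<bullet> x"
      using u by (simp add: inner_diff_left)
    then have "(x - y - d *\<^sub>R a, hom_ext p x (x - y - d *\<^sub>R a)) \<in> A"
      by (simp add: A_def)
    from nA[OF this] have "0 \<le> a \<bullet> (x - y) - d * (a \<bullet> a)"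
      using \<open>b = 0\<close> \<open>c \<ge> 0\<close> by (simp add: ab inner_diff_right)
    then show False
      using \<open>a \<bullet> (x - y) = 0\<close> mult_pos_pos[OF \<open>0 < d\<close>, of "a \<bullet> a"] \<open>a \<noteq> 0\<close> by simp
  qed
  then have "0 < b" using \<open>0 \<le> b\<close> by simp
  show thesis
  proof (rule that[of "- (1 / b) *\<^sub>R a"])
    show "- (1 / b) *\<^sub>R a \<bullet> (x - y) = p y"
      using e0 \<open>0 < b\<close> by (simp add: field_simps)
    fix z :: 'a assume z: "norm z = 1" "z \<noteq> x"
    then have "(x - z, p z) \<in> A"
      using hom_ext_diff[OF x z(1)] by (simp add: A_def)
    from nA[OF this] have "0 \<le> a \<bullet> (x - z) + b * p z"
      using \<open>c \<ge> 0\<close> by (simp add: ab)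
    then show "- (1 / b) *\<^sub>R a \<bullet> (x - z) \<le> p z"
      using \<open>0 < b\<close> by (simp add: field_simps)
  qed
qed

section \<open>Existence of support points\<close>

text \<open>The gradient of \<open>norm V - V \<bullet> y\<close> at \<open>V \<noteq> 0\<close> is
  \<open>V /\<^sub>R norm V - y\<close>, so \<open>U\<close> is a descent direction. The bound
  \<open>t < 1\<close> keeps the new point on the segment from \<open>V\<close> to
  \<open>V + U\<close>, for use in a convex set.\<close>

lemma norm_minus_inner_descent:
  fixes V U y :: "'a::real_inner"
  assumes "V \<noteq> 0" and neg: "U \<bullet> (V /\<^sub>R norm V - y) < 0"
  shows "\<exists>t. 0 < t \<and> t < 1 \<and> norm (V + t *\<^sub>R U) - (V + t *\<^sub>R U) \<bullet> y < norm V - V \<bullet> y"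
proof -
  define f where "f = (\<lambda>t. norm (V + t *\<^sub>R U) - (V + t *\<^sub>R U) \<bullet> y)"
  have "(norm has_derivative (\<lambda>h. h \<bullet> sgn V)) (at (V + 0 *\<^sub>R U))"
    using has_derivative_norm[OF \<open>V \<noteq> 0\<close>] by simp
  moreover have "((\<lambda>t. V + t *\<^sub>R U) has_derivative (\<lambda>t. t *\<^sub>R U)) (at (0::real))"
    by (auto intro!: derivative_eq_intros)
  ultimately have "((\<lambda>t. norm (V + t *\<^sub>R U)) has_derivative (\<lambda>t. (t *\<^sub>R U) \<bullet> sgn V)) (at 0)"
    using has_derivative_compose by fast
  then have "(f has_derivative (\<lambda>t. (t *\<^sub>R U) \<bullet> sgn V - (t *\<^sub>R U) \<bullet> y)) (at 0)"
    unfolding f_def by (auto intro!: derivative_eq_intros)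
  then have "(f has_real_derivative U \<bullet> (V /\<^sub>R norm V - y)) (at 0)"
    unfolding has_field_derivative_def
    by (rule has_derivative_eq_rhs) (auto simp: sgn_div_norm inner_diff_right algebra_simps)
  from DERIV_neg_dec_right[OF this neg] obtain d where
      d: "0 < d" "\<And>h. 0 < h \<Longrightarrow> h < d \<Longrightarrow> f h < f 0"
    by auto
  show ?thesis
    using d(1) d(2)[of "min d 1 / 2"]
    by (intro exI[of _ "min d 1 / 2"]) (auto simp: f_def)
qed

text \<open>\<open>D\<close> collects the gradients of the affine minorants of \<open>p\<close> on the sphere that touch \<open>p\<close>
  at \<open>y\<close>. Minimising \<open>norm W - W \<bullet> y\<close> over \<open>D\<close> gives a value at most \<open>p y\<close>: otherwise the
  subgradient belonging to the direction of the minimiser is a direction of descent.\<close>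

lemma condition_M_support_point:
  fixes p :: "'a::euclidean_space \<Rightarrow> real"
  assumes M: "condition_M p" and pos: "\<And>z. norm z = 1 \<Longrightarrow> 0 < p z" and y: "norm y = 1"
  obtains X where "norm X - X \<bullet> y = p y" "\<And>z. norm z = 1 \<Longrightarrow> norm X - X \<bullet> z \<le> p z"
proof -
  define f where "f = (\<lambda>W. norm W - W \<bullet> y)"
  define D where "D = {W. \<forall>z. norm z = 1 \<longrightarrow> p y + W \<bullet> (y - z) \<le> p z}"
  have subgrad: "\<exists>W\<in>D. W \<bullet> (x - y) = p y" if x: "norm x = 1" "x \<noteq> y" for x
  proof -
    obtain W where W: "W \<bullet> (x - y) = p y" "\<And>z. norm z = 1 \<Longrightarrow> z \<noteq> x \<Longrightarrow> W \<bullet> (x - z) \<le> p z"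
      using condition_M_subgradient[OF M x(1) y x(2)] by blast
    \<comment> \<open>At \<open>z = x\<close>, where the subgradient gives nothing, the affine
      function vanishes and positivity of \<open>p\<close> takes over.\<close>
    have "p y + W \<bullet> (y - z) \<le> p z" if z: "norm z = 1" for z
    proof -
      have "p y + W \<bullet> (y - z) = W \<bullet> (x - z)"
        by (simp add: W(1)[symmetric] inner_diff_right)
      also have "\<dots> \<le> p z"
        using W(2)[OF z] pos[OF z] by (cases "z = x") auto
      finally show ?thesis .
    qed
    then show ?thesis using W(1) by (auto simp: D_def)
  qed
  have "- y \<noteq> y"
  proof
    assume "- y = y"
    then have "(- y) \<bullet> y = y \<bullet> y" by (rule arg_cong)
    then show False using y by (simp add: dot_square_norm)
  qed
  \<comment> \<open>The direction opposite to \<open>y\<close> yields an element of \<open>D\<close>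
    where \<open>f\<close> is at least \<open>p y\<close>: the upper end for the intermediate value
    argument.\<close>
  then obtain W0 where W0: "W0 \<in> D" "W0 \<bullet> (- y - y) = p y"
    using subgrad[of "- y"] y by auto
  have fW0: "p y \<le> f W0"
    using W0(2) norm_minus_inner_nonneg[of "- y" W0] y by (simp add: f_def inner_diff_right)
  have contf: "continuous_on S f" for S
    unfolding f_def by (intro continuous_intros)
  have "convex D"
  proof -
    have "D = (\<Inter>z\<in>sphere 0 1. {W. (y - z) \<bullet> W \<le> p z - p y})"
      by (auto simp: D_def inner_commute algebra_simps)
    then show ?thesis
      by (auto intro!: convex_INT convex_halfspace_le)
  qed
  have "closed D"
    unfolding D_def by (intro closed_Collect_all closed_Collect_imp open_Collect_const
        closed_Collect_le continuous_intros)
  \<comment> \<open>\<open>D\<close> is unbounded in the direction \<open>- y\<close>, so the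
    minimum is sought on a sublevel set of \<open>f\<close>; testing at \<open>z = - y\<close>
    bounds \<open>W \<bullet> y\<close> from above and hence \<open>norm W\<close> there.\<close>
  define K where "K = {W \<in> D. f W \<le> f W0}"
  have "bounded K"
    unfolding bounded_iff
  proof (intro exI ballI)
    fix W assume W: "W \<in> K"
    moreover have "norm (- y) = 1" using y by simp
    ultimately have "p y + W \<bullet> (y - (- y)) \<le> p (- y)"
      unfolding K_def D_def by blast
    then have "2 * (W \<bullet> y) \<le> p (- y)"
      using pos[OF y] by (simp add: inner_add_right)
    then show "norm W \<le> f W0 + p (- y) / 2"
      using W by (simp add: K_def f_def)
  qed
  moreover have "closed K"
  proof -
    have "K = D \<inter> {W. f W \<le> f W0}" by (auto simp: K_def)
    then show ?thesis
      using \<open>closed D\<close> contf by (auto intro!: closed_Int closed_Collect_le continuous_on_const)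
  qed
  ultimately have "compact K"
    by (simp add: compact_eq_bounded_closed)
  moreover have "W0 \<in> K" using W0 by (simp add: K_def)
  ultimately obtain V where V: "V \<in> K" "\<And>W. W \<in> K \<Longrightarrow> f V \<le> f W"
    using continuous_attains_inf[of K f] contf[of K] by auto
  have "V \<in> D" using V by (simp add: K_def)
  have Vmin: "f V \<le> f W" if "W \<in> D" for W
    using V(2)[of W] V(2)[OF \<open>W0 \<in> K\<close>] that by (cases "f W \<le> f W0") (auto simp: K_def)
  have fV: "f V \<le> p y"
  proof (rule ccontr)
    assume gt: "\<not> f V \<le> p y"
    then have "V \<noteq> 0" using pos[OF y] by (auto simp: f_def)
    define x where "x = V /\<^sub>R norm V"
    have x: "norm x = 1" using \<open>V \<noteq> 0\<close> by (simp add: x_def)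
    have Vx: "V = norm V *\<^sub>R x" using \<open>V \<noteq> 0\<close> by (simp add: x_def)
    have inVx: "V \<bullet> x = norm V"
      by (subst Vx) (simp add: dot_square_norm x)
    have "x \<noteq> y" using gt pos[OF y] inVx by (auto simp: f_def)
    then obtain W where W: "W \<in> D" "W \<bullet> (x - y) = p y"
      using subgrad[OF x] by blast
    \<comment> \<open>The left side is the derivative of \<open>f\<close> at \<open>V\<close>
      towards \<open>W\<close>; \<open>V \<bullet> (x - y) = f V\<close> because \<open>x\<close> is
      the direction of \<open>V\<close>.\<close>
    have "(W - V) \<bullet> (x - y) = p y - f V"
      using W(2) inVx by (simp add: f_def inner_diff_left inner_diff_right)
    then have "(W - V) \<bullet> (V /\<^sub>R norm V - y) < 0"
      using gt by (simp add: x_def)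
    from norm_minus_inner_descent[OF \<open>V \<noteq> 0\<close> this] obtain t where
        t: "0 < t" "t < 1" "f (V + t *\<^sub>R (W - V)) < f V"
      by (auto simp: f_def)
    have "V + t *\<^sub>R (W - V) = (1 - t) *\<^sub>R V + t *\<^sub>R W"
      by (simp add: algebra_simps)
    then have "V + t *\<^sub>R (W - V) \<in> D"
      using \<open>convex D\<close> \<open>V \<in> D\<close> W t by (simp add: convex_alt)
    then show False using Vmin t by fastforce
  qed
  have "connected (f ` D)"
    using \<open>convex D\<close> contf by (intro connected_continuous_image convex_connected)
  then have "p y \<in> f ` D"
    using connectedD_interval[of "f ` D" "f V" "f W0" "p y"] \<open>V \<in> D\<close> W0 fV fW0 by blast
  then obtain X where X: "X \<in> D" "f X = p y" by auto
  show thesis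
  proof (rule that[of X])
    show "norm X - X \<bullet> y = p y" using X by (simp add: f_def)
    show "norm X - X \<bullet> z \<le> p z" if "norm z = 1" for z
    proof -
      \<comment> \<open>With \<open>f X = p y\<close>, membership in \<open>D\<close> turns into the
        inequalities defining the body.\<close>
      have "norm X - X \<bullet> z = p y + X \<bullet> (y - z)"
        using X(2) by (simp add: f_def inner_diff_right)
      then show ?thesis using X(1) that by (simp add: D_def)
    qed
  qed
qed

section \<open>The reflector with a given focal function, and its uniqueness\<close>

text \<open>A norm bound \<open>L\<close> on \<open>B\<close> makes
  \<open>norm X - X \<bullet> y\<close> Lipschitz in \<open>y\<close> with constant
  \<open>L\<close>, hence also the maximum \<open>p\<close>; on the compact sphere \<open>p\<close>
  then attains a positive minimum.\<close>

lemma positive_max_lower_bound: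
  fixes p :: "'a::euclidean_space \<Rightarrow> real"
  assumes "bounded B" and pos: "\<And>y. norm y = 1 \<Longrightarrow> 0 < p y"
    and att: "\<And>y. norm y = 1 \<Longrightarrow> \<exists>X\<in>B. norm X - X \<bullet> y = p y"
    and le: "\<And>y X. norm y = 1 \<Longrightarrow> X \<in> B \<Longrightarrow> norm X - X \<bullet> y \<le> p y"
  obtains m where "0 < m" "\<And>y. norm y = 1 \<Longrightarrow> m \<le> p y"
proof -
  obtain L where L: "\<And>X. X \<in> B \<Longrightarrow> norm X \<le> L" "0 < L"
    using \<open>bounded B\<close> by (auto simp: bounded_pos)
  have diff: "p y \<le> p z + L * dist y z" if yz: "norm y = 1" "norm z = 1" for y z
  proof -
    obtain X where X: "X \<in> B" "norm X - X \<bullet> y = p y"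
      using att[OF yz(1)] by blast
    have "p y = (norm X - X \<bullet> z) + X \<bullet> (z - y)"
      using X by (simp add: inner_diff_right)
    also have "\<dots> \<le> p z + norm X * norm (z - y)"
      using le[OF yz(2) X(1)] norm_cauchy_schwarz[of X "z - y"] by linarith
    also have "\<dots> \<le> p z + L * dist y z"
      using L X by (simp add: dist_norm norm_minus_commute mult_right_mono)
    finally show ?thesis .
  qed
  have "continuous_on (sphere 0 1) p"
  proof (rule lipschitz_on_continuous_on[of L])
    show "L-lipschitz_on (sphere 0 1) p"
    proof (rule lipschitz_onI)
      show "dist (p y) (p z) \<le> L * dist y z" if "y \<in> sphere 0 1" "z \<in> sphere 0 1" for y z
        using diff[of y z] diff[of z y] that by (auto simp: dist_real_def dist_commute abs_le_iff)
    qed (use L in simp)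
  qed
  moreover have "sphere (0::'a) 1 \<noteq> {}" by simp
  ultimately obtain z where z: "z \<in> sphere 0 1" "\<And>y. y \<in> sphere 0 1 \<Longrightarrow> p z \<le> p y"
    using continuous_attains_inf[OF compact_sphere] by blast
  show thesis
    by (rule that[of "p z"]) (use z pos in auto)
qed

text \<open>By \<open>condition_M_support_point\<close> every prescribed paraboloid touches the
  body, so no focal parameter shrinks when the intersection is formed.\<close>

lemma reflector_of_support_function:
  fixes p :: "'a::euclidean_space \<Rightarrow> real"
  assumes M: "condition_M p" and pos: "\<And>y. norm y = 1 \<Longrightarrow> 0 < p y"
    and bdd: "bounded (p ` sphere 0 1)"
  defines "B \<equiv> reflector_body (\<lambda>y. ennreal (p y))"
  shows "compact B" "interior B \<noteq> {}"
    and "\<And>y. norm y = 1 \<Longrightarrow> focal_function (frontier B) y = p y"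
proof -
  have B: "B = {X. \<forall>y. norm y = 1 \<longrightarrow> norm X - X \<bullet> y \<le> p y}"
    unfolding B_def using pos by (intro reflector_body_ennreal) (simp add: less_imp_le)
  have att: "\<exists>X\<in>B. norm X - X \<bullet> y = p y" if "norm y = 1" for y
    using condition_M_support_point[OF M pos that] unfolding B by blast
  obtain C where C: "\<And>y. norm y = 1 \<Longrightarrow> p y \<le> C"
    using bounded_imp_bdd_above[OF bdd] unfolding bdd_above_def by force
  have "bounded B"
    unfolding bounded_iff
  proof (intro exI ballI)
    fix X assume X: "X \<in> B"
    show "norm X \<le> max C 0"
    proof (cases "X = 0")
      case False
      \<comment> \<open>In the direction opposite to \<open>X\<close> the bound reads
        \<open>2 * norm X \<le> C\<close>.\<close>
      let ?y = "- (X /\<^sub>R norm X)"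
      have y: "norm ?y = 1" using False by simp
      then have "norm X - X \<bullet> ?y \<le> C" using X C[OF y] unfolding B by fastforce
      moreover have "X \<bullet> ?y = - norm X"
        using False by (simp add: dot_square_norm power2_eq_square)
      ultimately show ?thesis using norm_ge_zero[of X] by linarith
    qed simp
  qed
  moreover have "closed B"
    unfolding B by (intro closed_Collect_all closed_Collect_imp open_Collect_const
        closed_Collect_le continuous_intros)
  ultimately show comp: "compact B"
    by (simp add: compact_eq_bounded_closed)
  obtain m where m: "0 < m" "\<And>y. norm y = 1 \<Longrightarrow> m \<le> p y"
    by (rule positive_max_lower_bound[OF \<open>bounded B\<close> pos att]) (auto simp: B)
  \<comment> \<open>By Cauchy-Schwarz \<open>norm X - X \<bullet> y\<close> is at most
    \<open>2 * norm X\<close>, which is below \<open>m\<close> on this ball.\<close>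
  have "ball 0 (m / 2) \<subseteq> B"
  proof
    fix X :: 'a assume X: "X \<in> ball 0 (m / 2)"
    have "norm X - X \<bullet> y \<le> p y" if y: "norm y = 1" for y
      using m(2)[OF y] X norm_cauchy_schwarz[of X "- y"] y by simp
    then show "X \<in> B" by (simp add: B)
  qed
  then have "0 \<in> interior B"
    using m(1) by (auto simp: mem_interior intro!: exI[of _ "m / 2"])
  then show int: "interior B \<noteq> {}" by blast
  show "focal_function (frontier B) y = p y" if y: "norm y = 1" for y
  proof (rule antisym)
    obtain X where "X \<in> B" "norm X - X \<bullet> y = focal_function (frontier B) y"
      using focal_function_properties(1)[OF comp[unfolded B_def] int[unfolded B_def] y]
      unfolding B_def by blast
    then show "focal_function (frontier B) y \<le> p y"
      using y unfolding B by fastforce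
    show "p y \<le> focal_function (frontier B) y"
      using att[OF y] focal_function_properties(2)[OF comp[unfolded B_def] int[unfolded B_def] y]
      unfolding B_def by force
  qed
qed

text \<open>The defining parameters \<open>q\<close> may exceed the supporting ones, yet both
  intersections agree: a contact point lies in the body, so the supporting parameter is at most
  \<open>q y\<close>.\<close>

lemma reflector_determined_by_focal_function:
  fixes R :: "'a::euclidean_space set"
  assumes "R \<in> reflectors"
  shows "R = frontier (reflector_body (\<lambda>y. ennreal (focal_function R y)))"
proof -
  obtain q :: "'a \<Rightarrow> ennreal" where q: "R = frontier (reflector_body q)"
      "compact (reflector_body q)" "interior (reflector_body q) \<noteq> {}"
    using assms unfolding reflectors_def by blast
  note ff = focal_function_properties[OF q(2,3), folded q(1)]
  have "X \<in> reflector_body q \<longleftrightarrow> X \<in> reflector_body (\<lambda>y. ennreal (focal_function R y))" for X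
  proof
    assume "X \<in> reflector_body q"
    then show "X \<in> reflector_body (\<lambda>y. ennreal (focal_function R y))"
      using ff(2) by (auto simp: reflector_body_def paraboloid_body_def intro!: ennreal_leI)
  next
    assume X: "X \<in> reflector_body (\<lambda>y. ennreal (focal_function R y))"
    have "ennreal (norm X - X \<bullet> y) \<le> q y" if y: "norm y = 1" for y
    proof -
      obtain Z where Z: "Z \<in> reflector_body q" "norm Z - Z \<bullet> y = focal_function R y"
        using ff(1)[OF y] by blast
      have "ennreal (norm X - X \<bullet> y) \<le> ennreal (norm Z - Z \<bullet> y)"
        using X y Z by (auto simp: reflector_body_def paraboloid_body_def)
      also have "\<dots> \<le> q y"
        using Z(1) y by (auto simp: reflector_body_def paraboloid_body_def)
      finally show ?thesis .
    qed
    then show "X \<in> reflector_body q"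
      by (auto simp: reflector_body_def paraboloid_body_def)
  qed
  then have "reflector_body q = reflector_body (\<lambda>y. ennreal (focal_function R y))"
    by blast
  then show ?thesis using q(1) by simp
qed

lemma focal_function_necessary:
  fixes R :: "'a::euclidean_space set"
  assumes "2 \<le> DIM('a)" and "R \<in> reflectors"
  shows "\<And>y. norm y = 1 \<Longrightarrow> 0 < focal_function R y"
    and "bounded (focal_function R ` sphere 0 1)"
    and "condition_M (focal_function R)"
proof -
  obtain q :: "'a \<Rightarrow> ennreal" where q: "R = frontier (reflector_body q)"
      "compact (reflector_body q)" "interior (reflector_body q) \<noteq> {}"
    using assms unfolding reflectors_def by blast
  note ff = focal_function_properties[OF q(2,3), folded q(1)]
  show pos: "0 < focal_function R y" if y: "norm y = 1" for y
    using interior_imp_focal_positive[OF assms(1) q(3) y] ff(2)[OF y] by force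
  show "condition_M (focal_function R)"
    using ff by (rule condition_M_max)
  obtain L where L: "\<And>X. X \<in> reflector_body q \<Longrightarrow> norm X \<le> L"
    using compact_imp_bounded[OF q(2)] by (auto simp: bounded_iff)
  have "norm (focal_function R y) \<le> 2 * L" if y: "norm y = 1" for y
  proof -
    obtain X where X: "X \<in> reflector_body q" "norm X - X \<bullet> y = focal_function R y"
      using ff(1)[OF y] by blast
    then show ?thesis
      using pos[OF y] L[of X] norm_cauchy_schwarz[of X "- y"] y by simp
  qed
  then show "bounded (focal_function R ` sphere 0 1)"
    unfolding bounded_iff by (intro exI[of _ "2 * L"]) auto
qed

theorem theorem8:
  fixes n :: nat
  assumes "n \<ge> 1" and "DIM('a::euclidean_space) = n + 1"
  shows "(\<forall>R \<in> (reflectors :: 'a set set).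
            (\<forall>y\<in>sphere 0 1. 0 < focal_function R y) \<and>
            bounded (focal_function R ` sphere 0 1) \<and>
            condition_M (focal_function R)) \<and>
         (\<forall>p :: 'a \<Rightarrow> real.
            (\<forall>y\<in>sphere 0 1. 0 < p y) \<and> bounded (p ` sphere 0 1) \<and> condition_M p \<longrightarrow>
            (\<exists>!R. R \<in> reflectors \<and> (\<forall>y\<in>sphere 0 1. focal_function R y = p y)))"
proof (intro conjI ballI allI impI)
  fix R :: "'a set" assume R: "R \<in> reflectors"
  have dim: "2 \<le> DIM('a)" using assms by simp
  show "0 < focal_function R y" if "y \<in> sphere 0 1" for y
    using focal_function_necessary(1)[OF dim R] that by simp
  show "bounded (focal_function R ` sphere 0 1)" "condition_M (focal_function R)"
    using focal_function_necessary(2,3)[OF dim R] .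
next
  fix p :: "'a \<Rightarrow> real"
  assume p: "(\<forall>y\<in>sphere 0 1. 0 < p y) \<and> bounded (p ` sphere 0 1) \<and> condition_M p"
  define B where "B = reflector_body (\<lambda>y. ennreal (p y))"
  have B: "compact B" "interior B \<noteq> {}"
      "\<And>y. norm y = 1 \<Longrightarrow> focal_function (frontier B) y = p y"
    unfolding B_def using p reflector_of_support_function[of p] by auto
  show "\<exists>!R. R \<in> reflectors \<and> (\<forall>y\<in>sphere 0 1. focal_function R y = p y)"
  proof (rule ex1I)
    show "frontier B \<in> reflectors \<and> (\<forall>y\<in>sphere 0 1. focal_function (frontier B) y = p y)"
      using B by (auto simp: reflectors_def B_def)
    fix R assume R: "R \<in> reflectors \<and> (\<forall>y\<in>sphere 0 1. focal_function R y = p y)"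
    \<comment> \<open>The body sees its parameters at unit vectors only, where
      \<open>focal_function R\<close> and \<open>p\<close> agree.\<close>
    then have "reflector_body (\<lambda>y. ennreal (focal_function R y)) = B"
      by (simp add: B_def reflector_body_def)
    then show "R = frontier B"
      using R reflector_determined_by_focal_function by metis
  qed
qed

end
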